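(* Let $(X,\kappa)$ be a digital image. Then $(X,\kappa)$ has the fixed point property (FPP) if and only if $|X|=1$.
   Context: A digital image is a pair $(X,\kappa)$ where $\emptyset\neq X\subset\mathbf{Z}^n$ for some positive integer $n$ and $\kappa$ is an adjacency relation on $X$ (a symmetric, irreflexive relation, so that $(X,\kappa)$ is an undirected simple graph with vertex set $X$). A subset $A\subset X$ is $\kappa$-connected if for every two distinct points $x,y\in A$ there are $x=x_0,x_1,\ldots,x_c=y$ in $A$ with $x_i,x_{i+1}$ $\kappa$-adjacent for all $0\le i<c$. A function $f:(X,\kappa)\to(Y,\lambda)$ between digital images is $(\kappa,\lambda)$-continuous if $f(A)$ is $\lambda$-connected for every $\kappa$-connected $A\subset X$; equivalently, whenever $x_0,x_1\in X$ are $\kappa$-adjacent, $f(x_0)$ and $f(x_1)$ are equal or $\lambda$-adjacent. A fixed point of $f:X\to X$ is a point $x\in X$ with $f(x)=x$. The digital image $(X,\kappa)$ has the fixed point property (FPP) if every $(\kappa,\kappa)$-continuous function $f:X\to X$ has a fixed point. $|X|$ denotes the number of points of $X$. *)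

theory Defs
  imports "HOL-Analysis.Finite_Cartesian_Product" "HOL-Library.FuncSet"
begin

text \<open>
  \<open>\<int>\<^sup>n\<close> is rendered as \<^typ>\<open>int ^ 'n\<close> with \<open>n = CARD('n) \<ge> 1\<close>. An image need not be finite.
\<close>

definition digital_image :: "(int ^ 'n::finite) set \<Rightarrow> (int ^ 'n) rel \<Rightarrow> bool" where
  "digital_image X \<kappa> \<longleftrightarrow> X \<noteq> {} \<and> \<kappa> \<subseteq> X \<times> X \<and> sym \<kappa> \<and> irrefl \<kappa>"

definition dconnected :: "'a rel \<Rightarrow> 'a set \<Rightarrow> bool" where
  "dconnected \<kappa> A \<longleftrightarrow>
     (\<forall>x\<in>A. \<forall>y\<in>A. x \<noteq> y \<longrightarrow>
        (\<exists>(p :: nat \<Rightarrow> 'a) c. p 0 = x \<and> p c = y \<and> (\<forall>i\<le>c. p i \<in> A) \<and>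
           (\<forall>i<c. (p i, p (Suc i)) \<in> \<kappa>)))"

text \<open>Only the values of \<open>f\<close> on \<open>X\<close> matter.\<close>

definition dcontinuous :: "'a set \<Rightarrow> 'a rel \<Rightarrow> 'b set \<Rightarrow> 'b rel \<Rightarrow> ('a \<Rightarrow> 'b) \<Rightarrow> bool" where
  "dcontinuous X \<kappa> Y \<mu> f \<longleftrightarrow>
     f \<in> X \<rightarrow> Y \<and> (\<forall>A\<subseteq>X. dconnected \<kappa> A \<longrightarrow> dconnected \<mu> (f ` A))"

definition FPP :: "'a set \<Rightarrow> 'a rel \<Rightarrow> bool" where
  "FPP X \<kappa> \<longleftrightarrow> (\<forall>f. dcontinuous X \<kappa> X \<kappa> f \<longrightarrow> (\<exists>x\<in>X. f x = x))"

end

theory Submission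
  imports Defs
begin

text \<open>
  If \<open>X\<close> has two points, choose distinct \<open>a, b \<in> X\<close>, adjacent unless there is no adjacent pair at
  all. The map that sends \<open>a\<close> to \<open>b\<close> and every other point to \<open>a\<close> has no fixed point. It is
  continuous: either every subset of its image \<open>{a, b}\<close> is connected, or only sets with at most
  one point are connected.
\<close>

text \<open>Two distinct points of \<open>A\<close> can only be \<open>a\<close> and
  \<open>b\<close>, so the edge itself joins them, in one direction or, by symmetry, the
  other.\<close>

lemma dconnected_subset_edge:
  assumes "sym \<kappa>" "(a, b) \<in> \<kappa>" "A \<subseteq> {a, b}"
  shows "dconnected \<kappa> A"
  unfolding dconnected_def
proof (intro ballI impI)
  fix x y assume "x \<in> A" "y \<in> A" "x \<noteq> y"
  then have "(x, y) \<in> \<kappa>"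
    using assms by (auto dest: symD)
  then show "\<exists>(p :: nat \<Rightarrow> 'a) c. p 0 = x \<and> p c = y \<and> (\<forall>i\<le>c. p i \<in> A) \<and>
      (\<forall>i<c. (p i, p (Suc i)) \<in> \<kappa>)"
    using \<open>x \<in> A\<close> \<open>y \<in> A\<close>
    \<comment> \<open>A path of length 1; only its values at 0 and 1 matter.\<close>
    by (intro exI[of _ "\<lambda>i. if i = 0 then x else y"] exI[of _ 1]) auto
qed

text \<open>A path between distinct points has a first step, which the empty relation cannot
  supply.\<close>

lemma dconnected_empty_rel_eq:
  assumes "dconnected {} A" "x \<in> A" "y \<in> A"
  shows "x = y"
proof (rule ccontr)
  assume "x \<noteq> y"
  then obtain p :: "nat \<Rightarrow> 'a" and c where "p 0 = x" "p c = y" "\<forall>i<c. (p i, p (Suc i)) \<in> {}"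
    using assms(1)[unfolded dconnected_def, rule_format, OF assms(2,3)] by auto
  with \<open>x \<noteq> y\<close> show False by (cases c) auto
qed

text \<open>Connected sets here have at most one point, hence so do their images, which are then
  vacuously connected.\<close>

lemma dcontinuous_empty_rel:
  assumes "f \<in> X \<rightarrow> Y"
  shows "dcontinuous X {} Y \<mu> f"
  using assms unfolding dcontinuous_def
  by (auto simp: dconnected_def[of \<mu>] dest: dconnected_empty_rel_eq)

lemma not_FPP:
  assumes "sym \<kappa>" "irrefl \<kappa>" "\<kappa> \<subseteq> X \<times> X" "u \<in> X" "v \<in> X" "u \<noteq> v"
  shows "\<not> FPP X \<kappa>"
proof -
  obtain a b where ab: "a \<in> X" "b \<in> X" "a \<noteq> b" "\<kappa> = {} \<or> (a, b) \<in> \<kappa>"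
  proof (cases "\<kappa> = {}")
    case False
    then obtain a b where "(a, b) \<in> \<kappa>" by auto
    moreover from this have "a \<noteq> b"
      using assms by (auto simp: irrefl_def)
    ultimately show ?thesis
      using that assms by blast
  qed (use that assms in blast)
  define f where "f x = (if x = a then b else a)" for x
  have f: "f \<in> X \<rightarrow> X"
    using ab by (auto simp: f_def)
  have "dcontinuous X \<kappa> X \<kappa> f"
  proof (cases "\<kappa> = {}")
    case True
    then show ?thesis using dcontinuous_empty_rel[OF f] by simp
  next
    case False
    \<comment> \<open>This holds for every \<open>A\<close>, so connectedness of \<open>A\<close>
      need not be examined.\<close>
    have "f ` A \<subseteq> {a, b}" for A by (auto simp: f_def)
    then show ?thesis
      using f False ab(4) by (simp add: dcontinuous_def dconnected_subset_edge[OF assms(1)])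
  qed
  moreover have "f x \<noteq> x" for x
    using ab by (simp add: f_def)
  ultimately show ?thesis
    unfolding FPP_def by blast
qed

theorem theorem3p1:
  fixes X :: "(int ^ 'n::finite) set" and \<kappa> :: "(int ^ 'n) rel"
  assumes "digital_image X \<kappa>"
  shows "FPP X \<kappa> \<longleftrightarrow> card X = 1"
proof
  assume FPP: "FPP X \<kappa>"
  from assms obtain x where "x \<in> X"
    unfolding digital_image_def by blast
  moreover have "y = x" if "y \<in> X" for y
    using not_FPP[of \<kappa> X x y] that assms FPP \<open>x \<in> X\<close> unfolding digital_image_def by blast
  ultimately have "X = {x}" by blast
  then show "card X = 1" by simp
next
  assume "card X = 1"
  \<comment> \<open>Infinite sets have \<open>card\<close> 0, so cardinality 1 does force a
    singleton.\<close>
  then obtain x where "X = {x}"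
    by (auto simp: card_1_singleton_iff)
  then show "FPP X \<kappa>"
    unfolding FPP_def dcontinuous_def by auto
qed

end
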